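(* Let $s\in(0,1/8)$. Then the identity map $\mathrm{id}:\mathbb S^1\to\mathbb S^1$ is not a minimizer of $E_s$ among degree $1$ maps $\mathbb S^1\to\mathbb S^1$, i.e. $$\#_s 1<E_s(\mathrm{id}).$$ Indeed, $\mathrm{id}$ is not even stable in the $W^{s,1/s}$-topology: for every $r>0$ there is a map $u\in W^{s,1/s}(\mathbb S^1,\mathbb S^1)$ of degree $1$ with $[u-\mathrm{id}]_{W^{s,1/s}(\mathbb S^1)}<r$ and $E_s(u)<E_s(\mathrm{id})$.
   Context: $\mathbb S^1\subset\mathbb C\simeq\mathbb R^2$ is the unit circle, $|x-y|$ is the Euclidean distance in $\mathbb C$, and $dx,dy$ denote arclength measure on $\mathbb S^1$. For $s\in(0,1)$ and $u:\mathbb S^1\to\mathbb S^1\subset\mathbb R^2$, $$E_s(u)=\iint_{\mathbb S^1\times\mathbb S^1}\frac{|u(x)-u(y)|^{1/s}}{|x-y|^2}\,dx\,dy .$$ For $0<s<1$, $1\le q<\infty$, $[f]_{W^{s,q}(\mathbb S^1)}^q=\iint_{\mathbb S^1\times\mathbb S^1}\frac{|f(x)-f(y)|^q}{|x-y|^{1+sq}}\,dx\,dy$, and $W^{s,1/s}(\mathbb S^1,\mathbb S^1)$ is the set of measurable maps $u:\mathbb S^1\to\mathbb S^1$ with $[u]_{W^{s,1/s}(\mathbb S^1)}<\infty$ (equivalently $E_s(u)<\infty$). The degree $\deg u\in\mathbb Z$ of $u\in W^{s,1/s}(\mathbb S^1,\mathbb S^1)$ is the usual (VMO) degree, which coincides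 with the topological degree for continuous maps. For $d\in\mathbb Z$, $\#_s d=\inf\{E_s(u): u\in W^{s,1/s}(\mathbb S^1,\mathbb S^1),\ \deg u=d\}$. *)

theory Defs
  imports "HOL-Complex_Analysis.Complex_Analysis"
begin

abbreviation unit_circle :: "complex set"
  where "unit_circle \<equiv> sphere 0 1"

text \<open>Completed, so that measurable means Lebesgue measurable on the circle.\<close>

definition arclength :: "complex measure"
  where "arclength =
    completion (distr (restrict_space lborel {0..<2 * pi}) (restrict_space borel unit_circle) cis)"

text \<open>Both integrands below are \<open>0\<close> on the diagonal by the convention \<open>a / 0 = 0\<close>;
  the diagonal is a null set.\<close>

definition energy :: "real \<Rightarrow> (complex \<Rightarrow> complex) \<Rightarrow> ennreal"
  where "energy s u =
    (\<integral>\<^sup>+ (x, y). ennreal (norm (u x - u y) powr (1 / s) / norm (x - y) ^ 2)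
      \<partial>(arclength \<Otimes>\<^sub>M arclength))"

definition gagliardo_integral :: "real \<Rightarrow> real \<Rightarrow> (complex \<Rightarrow> complex) \<Rightarrow> ennreal"
  where "gagliardo_integral s q f =
    (\<integral>\<^sup>+ (x, y). ennreal (norm (f x - f y) powr q / norm (x - y) powr (1 + s * q))
      \<partial>(arclength \<Otimes>\<^sub>M arclength))"

definition gagliardo_seminorm :: "real \<Rightarrow> real \<Rightarrow> (complex \<Rightarrow> complex) \<Rightarrow> ennreal"
  where "gagliardo_seminorm s q f =
    (if gagliardo_integral s q f = \<infinity> then \<infinity>
     else ennreal (enn2real (gagliardo_integral s q f) powr (1 / q)))"

text \<open>The space \<open>W\<close> with exponents \<open>s\<close> and \<open>1/s\<close> of maps from the circle to itself;
  values off the circle are unconstrained and play no role.\<close>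

definition sobolev_circle_maps :: "real \<Rightarrow> (complex \<Rightarrow> complex) set"
  where "sobolev_circle_maps s =
    {u \<in> unit_circle \<rightarrow> unit_circle.
       u \<in> borel_measurable arclength \<and> gagliardo_seminorm s (1 / s) u < \<infinity>}"

definition circle_degree :: "(complex \<Rightarrow> complex) \<Rightarrow> complex"
  where "circle_degree f = winding_number (f \<circ> circlepath 0 1) 0"

text \<open>The mean of \<open>u\<close> over the geodesic ball of radius \<open>\<epsilon>\<close> about \<open>x\<close> in the unit circle
  (for \<open>\<epsilon> < pi\<close>).\<close>

definition arc_mean :: "(complex \<Rightarrow> complex) \<Rightarrow> real \<Rightarrow> complex \<Rightarrow> complex"
  where "arc_mean u \<epsilon> x = (1 / (2 * \<epsilon>)) *\<^sub>R (LINT t:{-\<epsilon>..\<epsilon>}|lebesgue. u (x * cis t))"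

text \<open>The degree of Brezis and Nirenberg: if \<open>u\<close> is a VMO map of the circle to itself, its means
  are continuous and, for small \<open>\<epsilon>\<close>, nowhere zero, and the degree of their projection to the
  circle (\<open>sgn z = z / norm z\<close>) is eventually constant. All maps in \<open>sobolev_circle_maps s\<close>,
  \<open>0 < s < 1\<close>, are VMO.\<close>

definition has_vmo_degree :: "(complex \<Rightarrow> complex) \<Rightarrow> int \<Rightarrow> bool"
  where "has_vmo_degree u d \<longleftrightarrow>
    (\<forall>\<^sub>F \<epsilon> in at_right 0.
       (\<forall>x\<in>unit_circle. arc_mean u \<epsilon> x \<noteq> 0) \<and>
       circle_degree (\<lambda>x. sgn (arc_mean u \<epsilon> x)) = of_int d)"

definition vmo_degree :: "(complex \<Rightarrow> complex) \<Rightarrow> int"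
  where "vmo_degree u = (THE d. has_vmo_degree u d)"

lemma vmo_degree_eqI:
  assumes "has_vmo_degree u d"
  shows "vmo_degree u = d"
  unfolding vmo_degree_def
proof (rule the_equality)
  show "has_vmo_degree u d" by (fact assms)
next
  fix e assume "has_vmo_degree u e"
  then have "\<forall>\<^sub>F \<epsilon> in at_right (0::real). (of_int e :: complex) = of_int d"
    using assms unfolding has_vmo_degree_def by eventually_elim simp
  then show "e = d"
    by (simp add: eventually_const)
qed

definition min_energy :: "real \<Rightarrow> int \<Rightarrow> ennreal"
  where "min_energy s d = Inf {energy s u | u. u \<in> sobolev_circle_maps s \<and> vmo_degree u = d}"

end

theory Submission imports Defs begin

text \<open>
  Write \<open>p = 1 / s\<close> and perturb the identity by a third harmonic: \<open>u\<^sub>\<epsilon>\<close> sends \<open>cis \<theta>\<close> to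
  \<open>cis (\<theta> + \<epsilon> * sin (3 * \<theta>))\<close>. Since \<open>norm (cis a - cis b) = 2 * \<bar>sin ((a - b) / 2)\<bar>\<close>,
  parametrising pairs of points by half their angular difference \<open>t\<close> and by their mean angle \<open>m\<close>
  turns the energy, up to a constant factor, into the integral of
  \<open>\<bar>sin (t + h)\<bar> powr p / (sin t)\<^sup>2\<close> with \<open>h = \<epsilon> * sin (3 * t) * cos (3 * m)\<close>.

  Expand \<open>\<bar>sin\<bar> powr p\<close> to second order in \<open>h\<close>. The linear term is killed by the integration over
  \<open>m\<close>, the identity being critical. The cubic remainder is harmless because
  \<open>\<bar>h\<bar> \<le> 3 * \<epsilon> * \<bar>sin t\<bar>\<close>, so that the singular weight is absorbed. What decides is the second
  variation, the integral of
  \<open>((p - 1) * \<bar>sin t\<bar> powr (p - 2) - p * \<bar>sin t\<bar> powr p) * (sin (3 * t) / sin t)\<^sup>2\<close> over \<open>{0..pi}\<close>.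
  By the Wallis recursion it equals \<open>16 * (8 - p) / ((p + 2) * (p + 4))\<close> times the integral of
  \<open>\<bar>sin t\<bar> powr p\<close>, which is negative precisely when \<open>p > 8\<close>, that is \<open>s < 1 / 8\<close>. (For the first
  harmonic the same integral vanishes, reflecting the invariance of the energy under Moebius
  reparametrisations of the circle; for the second it is positive.) The computation is
  \<open>second_variation_has_integral\<close>, and \<open>energy_wiggle_less\<close> draws the conclusion.

  The remaining requirements are soft. The map \<open>u\<^sub>\<epsilon> - id\<close> is Lipschitz with constant \<open>4 * \<epsilon>\<close>, and
  the Gagliardo seminorm is bounded by a multiple of the Lipschitz constant. A Lipschitz map
  uniformly close to the identity has means uniformly close to the identity, hence degree \<open>1\<close>.
\<close>

section \<open>Double integrals over the circle\<close>

lemma measurable_arclength_borel: "(\<lambda>x. x) \<in> arclength \<rightarrow>\<^sub>M (borel :: complex measure)"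
  unfolding arclength_def
  by (rule measurable_completion)
     (simp add: measurable_distr_eq1 measurable_restrict_space1)

lemma borel_measurable_cis [measurable]: "cis \<in> borel_measurable borel"
  by (intro borel_measurable_continuous_onI continuous_intros)

lemma cis_measurable_circle:
  "cis \<in> restrict_space lborel {0..<2 * pi} \<rightarrow>\<^sub>M restrict_space borel unit_circle"
  by (rule measurable_restrict_space2)
     (auto intro!: measurable_restrict_space1)

lemma nn_integral_arclength:
  fixes f :: "complex \<Rightarrow> ennreal"
  assumes f [measurable]: "f \<in> borel_measurable borel"
  shows "(\<integral>\<^sup>+x. f x \<partial>arclength) = (\<integral>\<^sup>+\<theta>\<in>{0..<2 * pi}. f (cis \<theta>) \<partial>lborel)"
proof -
  have "(\<integral>\<^sup>+x. f x \<partial>arclength) =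
     (\<integral>\<^sup>+x. f x \<partial>distr (restrict_space lborel {0..<2 * pi}) (restrict_space borel unit_circle) cis)"
    unfolding arclength_def by (rule nn_integral_completion)
  also have "\<dots> = (\<integral>\<^sup>+\<theta>. f (cis \<theta>) \<partial>restrict_space lborel {0..<2 * pi})"
    by (rule nn_integral_distr[OF cis_measurable_circle])
       (simp add: measurable_distr_eq1 measurable_restrict_space1)
  also have "\<dots> = (\<integral>\<^sup>+\<theta>\<in>{0..<2 * pi}. f (cis \<theta>) \<partial>lborel)"
    by (rule nn_integral_restrict_space) simp
  finally show ?thesis .
qed

lemma finite_measure_arclength: "finite_measure arclength"
proof (rule finite_measureI)
  have "emeasure arclength (space arclength) = (\<integral>\<^sup>+x. 1 \<partial>arclength)"
    by simp
  also have "\<dots> = (\<integral>\<^sup>+\<theta>\<in>{0..<2 * pi}. 1 \<partial>lborel)"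
    by (rule nn_integral_arclength) simp
  also have "\<dots> = ennreal (2 * pi)"
    by simp
  finally show "emeasure arclength (space arclength) \<noteq> \<infinity>"
    by simp
qed

lemma nn_integral_arclength_pair:
  fixes f :: "complex \<Rightarrow> complex \<Rightarrow> ennreal"
  assumes f [measurable]: "(\<lambda>(x, y). f x y) \<in> borel_measurable (borel \<Otimes>\<^sub>M borel)"
  shows "(\<integral>\<^sup>+(x, y). f x y \<partial>(arclength \<Otimes>\<^sub>M arclength)) =
    (\<integral>\<^sup>+\<beta>\<in>{0..<2 * pi}. (\<integral>\<^sup>+\<alpha>\<in>{0..<2 * pi}. f (cis \<alpha>) (cis \<beta>) \<partial>lborel) \<partial>lborel)"
proof -
  interpret finite_measure arclength by (rule finite_measure_arclength)
  interpret pair_sigma_finite arclength arclength ..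
  have m: "(\<lambda>(x, y). f x y) \<in> borel_measurable (arclength \<Otimes>\<^sub>M arclength)"
    using measurable_compose[OF measurable_Pair[OF measurable_compose[OF
        measurable_fst measurable_arclength_borel]
       measurable_compose[OF measurable_snd measurable_arclength_borel]] f]
    by (simp add: case_prod_beta)
  have "(\<integral>\<^sup>+(x, y). f x y \<partial>(arclength \<Otimes>\<^sub>M arclength)) = (\<integral>\<^sup>+y. (\<integral>\<^sup>+x. f x y \<partial>arclength) \<partial>arclength)"
    using nn_integral_snd[OF m] by simp
  also have "\<dots> = (\<integral>\<^sup>+y. (\<integral>\<^sup>+\<alpha>\<in>{0..<2 * pi}. f (cis \<alpha>) y \<partial>lborel) \<partial>arclength)"
    by (intro nn_integral_cong nn_integral_arclength) measurable
  also have "\<dots> = (\<integral>\<^sup>+\<beta>\<in>{0..<2 * pi}. (\<integral>\<^sup>+\<alpha>\<in>{0..<2 * pi}. f (cis \<alpha>) (cis \<beta>) \<partial>lborel) \<partial>lborel)"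
    by (rule nn_integral_arclength) measurable
  finally show ?thesis .
qed

text \<open>Cut the shifted interval at \<open>T\<close> and move the part beyond \<open>T\<close> back by one period.\<close>

lemma nn_integral_shift_periodic:
  fixes g :: "real \<Rightarrow> ennreal"
  assumes g [measurable]: "g \<in> borel_measurable borel"
    and per: "\<And>x. g (x + T) = g x" and c: "0 \<le> c" "c \<le> T"
  shows "(\<integral>\<^sup>+x\<in>{0..<T}. g (x + c) \<partial>lborel) = (\<integral>\<^sup>+x\<in>{0..<T}. g x \<partial>lborel)"
proof -
  have shift: "(\<integral>\<^sup>+x. h x \<partial>lborel) = (\<integral>\<^sup>+x. h (x + a) \<partial>lborel)"
    if [measurable]: "h \<in> borel_measurable borel" for h :: "real \<Rightarrow> ennreal" and a
    using nn_integral_real_affine[of h 1 a] by (simp add: add.commute)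
  have "(\<integral>\<^sup>+x\<in>{0..<T}. g (x + c) \<partial>lborel) = (\<integral>\<^sup>+x\<in>{c..<T + c}. g x \<partial>lborel)"
    by (subst (2) shift[where a = c]) (auto intro!: nn_integral_cong simp: indicator_def)
  also have "\<dots> = (\<integral>\<^sup>+x\<in>{c..<T}. g x \<partial>lborel) + (\<integral>\<^sup>+x\<in>{T..<T + c}. g x \<partial>lborel)"
    using c by (subst nn_integral_add[symmetric]) (auto intro!: nn_integral_cong
      simp: indicator_def)
  also have "(\<integral>\<^sup>+x\<in>{T..<T + c}. g x \<partial>lborel) = (\<integral>\<^sup>+x\<in>{0..<c}. g x \<partial>lborel)"
    by (subst shift[where a = T]) (auto intro!: nn_integral_cong simp: indicator_def per)
  also have "(\<integral>\<^sup>+x\<in>{c..<T}. g x \<partial>lborel) + (\<integral>\<^sup>+x\<in>{0..<c}. g x \<partial>lborel)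
    = (\<integral>\<^sup>+x\<in>{0..<T}. g x \<partial>lborel)"
    using c by (subst nn_integral_add[symmetric]) (auto intro!: nn_integral_cong
      simp: indicator_def)
  finally show ?thesis .
qed

text \<open>Both rotations of the variables are legitimate because the integrand is periodic in each
  angle: \<open>d\<close> is the difference of the two angles and \<open>m\<close> their mean. The symmetric form makes
  the increment of \<open>sin (3 * \<theta>)\<close> factor into a function of \<open>d\<close> times a function of \<open>m\<close>.\<close>

lemma nn_integral_arclength_pair_difference:
  fixes f :: "complex \<Rightarrow> complex \<Rightarrow> ennreal"
  assumes f [measurable]: "(\<lambda>(x, y). f x y) \<in> borel_measurable (borel \<Otimes>\<^sub>M borel)"
  shows "(\<integral>\<^sup>+(x, y). f x y \<partial>(arclength \<Otimes>\<^sub>M arclength)) =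
    (\<integral>\<^sup>+d\<in>{0..<2 * pi}. (\<integral>\<^sup>+m\<in>{0..<2 * pi}. f (cis (m + d / 2)) (cis (m - d / 2)) \<partial>lborel) \<partial>lborel)"
proof -
  have per: "cis (x + 2 * pi + y) = cis (x + y)" "cis (x + 2 * pi - y) = cis (x - y)" for x y
    by (simp_all add: complex_eq_iff cos_add cos_diff sin_add sin_diff)
  have fm [measurable (raw)]: "(\<lambda>x. f (g x) (h x)) \<in> borel_measurable M"
    if "g \<in> borel_measurable M" "h \<in> borel_measurable M" for g h and M :: "'m measure"
    using measurable_compose[OF measurable_Pair[OF that] f] by simp
  have "(\<integral>\<^sup>+(x, y). f x y \<partial>(arclength \<Otimes>\<^sub>M arclength)) =
    (\<integral>\<^sup>+b\<in>{0..<2 * pi}. (\<integral>\<^sup>+a\<in>{0..<2 * pi}. f (cis a) (cis b) \<partial>lborel) \<partial>lborel)"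
    by (rule nn_integral_arclength_pair) fact
  also have "\<dots> = (\<integral>\<^sup>+b\<in>{0..<2 * pi}. (\<integral>\<^sup>+d\<in>{0..<2 * pi}. f (cis (d + b)) (cis b) \<partial>lborel) \<partial>lborel)"
  proof (intro nn_integral_cong)
    fix b :: real
    show "(\<integral>\<^sup>+a\<in>{0..<2 * pi}. f (cis a) (cis b) \<partial>lborel) * indicator {0..<2 * pi} b =
      (\<integral>\<^sup>+d\<in>{0..<2 * pi}. f (cis (d + b)) (cis b) \<partial>lborel) * indicator {0..<2 * pi} b"
      using nn_integral_shift_periodic[of "\<lambda>a. f (cis a) (cis b)" "2 * pi" b] per[of _ 0]
      by (auto simp: indicator_def)
  qed
  also have "\<dots> = (\<integral>\<^sup>+b. (\<integral>\<^sup>+d. f (cis (d + b)) (cis b) * indicator {0..<2 * pi} d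
    * indicator {0..<2 * pi} b \<partial>lborel) \<partial>lborel)"
    by (intro nn_integral_cong nn_integral_multc[symmetric]) measurable
  also have "\<dots> = (\<integral>\<^sup>+d. (\<integral>\<^sup>+b. f (cis (d + b)) (cis b) * indicator {0..<2 * pi} d
    * indicator {0..<2 * pi} b \<partial>lborel) \<partial>lborel)"
    by (rule lborel_pair.Fubini') measurable
  also have "\<dots> = (\<integral>\<^sup>+d\<in>{0..<2 * pi}. (\<integral>\<^sup>+b\<in>{0..<2 * pi}. f (cis (d + b)) (cis b) \<partial>lborel) \<partial>lborel)"
    by (intro nn_integral_cong, subst nn_integral_multc[symmetric]) (measurable, simp add: mult_ac)
  also have "\<dots> = (\<integral>\<^sup>+d\<in>{0..<2 * pi}. (\<integral>\<^sup>+m\<in>{0..<2 * pi}.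
    f (cis (m + d / 2)) (cis (m - d / 2)) \<partial>lborel) \<partial>lborel)"
  proof (intro nn_integral_cong)
    fix d :: real
    show "(\<integral>\<^sup>+b\<in>{0..<2 * pi}. f (cis (d + b)) (cis b) \<partial>lborel) * indicator {0..<2 * pi} d =
      (\<integral>\<^sup>+m\<in>{0..<2 * pi}. f (cis (m + d / 2)) (cis (m - d / 2)) \<partial>lborel) * indicator {0..<2 * pi} d"
    proof (cases "d \<in> {0..<2 * pi}")
      case True
      \<comment> \<open>substitute \<open>b = m - d / 2\<close>\<close>
      have "d + b = b + d / 2 + d / 2" for b by simp
      with True show ?thesis
        using nn_integral_shift_periodic[of
          "\<lambda>m. f (cis (m + d / 2)) (cis (m - d / 2))" "2 * pi" "d / 2"]
        by (simp add: per)
    qed simp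
  qed
  finally show ?thesis .
qed

section \<open>Powers of the absolute sine\<close>

text \<open>For \<open>a > 1\<close> the function is differentiable at the origin too, where the difference quotient is
  \<open>\<plusminus> \<bar>h\<bar> powr (a - 1)\<close>; away from it, it is \<open>(y\<^sup>2) powr (a / 2)\<close>.\<close>

lemma abs_powr_DERIV:
  fixes a x :: real
  assumes "a > 1"
  shows "((\<lambda>y. \<bar>y\<bar> powr a) has_real_derivative a * \<bar>x\<bar> powr (a - 2) * x) (at x)"
proof (cases "x = 0")
  case True
  have "\<bar>\<bar>h\<bar> powr a / h\<bar> = \<bar>h\<bar> powr (a - 1)" for h :: real
    by (cases "h = 0") (simp_all add: powr_diff abs_divide)
  moreover have "((\<lambda>h. \<bar>h\<bar> powr (a - 1)) \<longlongrightarrow> \<bar>0::real\<bar> powr (a - 1)) (at 0)"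
    using assms by (intro tendsto_intros) auto
  ultimately have "((\<lambda>h. \<bar>h\<bar> powr a / h) \<longlongrightarrow> 0) (at (0::real))"
    by (subst tendsto_rabs_zero_iff[symmetric]) simp
  then show ?thesis
    using True assms by (simp add: DERIV_def)
next
  case False
  \<comment> \<open>the square makes the base positive on both sides of the origin\<close>
  have sq: "(y\<^sup>2) powr b = \<bar>y\<bar> powr (2 * b)" for y b :: real
    by (metis abs_ge_zero power2_abs powr_numeral powr_powr)
  have "((\<lambda>y. (y\<^sup>2) powr (a / 2)) has_real_derivative a / 2 * (x\<^sup>2) powr (a / 2 - of_nat 1)
    * (2 * x)) (at x)"
    using False by (intro DERIV_fun_powr) (auto intro!: derivative_eq_intros)
  then show ?thesis
    by (simp add: sq right_diff_distrib mult.assoc)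
qed

abbreviation sin_powr :: "real \<Rightarrow> real \<Rightarrow> real"
  where "sin_powr a t \<equiv> \<bar>sin t\<bar> powr a"

lemma sin_powr_mult_sin_square: "sin_powr a t * (sin t)\<^sup>2 = sin_powr (a + 2) t"
  by (cases "sin t = 0") (simp_all add: powr_add)

lemma continuous_on_sin_powr [continuous_intros]:
  fixes f :: "real \<Rightarrow> real"
  shows "continuous_on A f \<Longrightarrow> a > 0 \<Longrightarrow> continuous_on A (\<lambda>x. sin_powr a (f x))"
  by (intro continuous_on_powr' continuous_on_rabs continuous_on_sin continuous_on_const) auto

lemma sin_powr_le_one: "0 \<le> a \<Longrightarrow> sin_powr a t \<le> 1"
  using powr_mono2[of a "\<bar>sin t\<bar>" 1] by simp

lemma sin_powr_DERIV:
  assumes "a > 1"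
  shows "(sin_powr a has_real_derivative a * sin_powr (a - 2) t * (sin t * cos t)) (at t)"
  using DERIV_chain2[OF abs_powr_DERIV[OF assms] DERIV_sin] by (simp add: mult_ac)

text \<open>This single formula serves twice: with \<open>a = p - 2\<close> it gives the second derivative of
  \<open>sin_powr p\<close>, and integrated over a period it is the Wallis recursion between the integrals of
  \<open>sin_powr a\<close> and \<open>sin_powr (a + 2)\<close>.\<close>

lemma sin_powr_sin_cos_DERIV:
  assumes "a > 1"
  shows "((\<lambda>t. sin_powr a t * (sin t * cos t)) has_real_derivative
      (a + 1) * sin_powr a t - (a + 2) * sin_powr (a + 2) t) (at t)"
proof -
  have "((\<lambda>t. sin_powr a t * (sin t * cos t)) has_real_derivative
      sin_powr a t * (cos t * cos t - sin t * sin t)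
        + a * sin_powr (a - 2) t * (sin t * cos t) * (sin t * cos t)) (at t)"
    by (rule derivative_eq_intros sin_powr_DERIV[OF assms] refl | simp)+
  moreover have "sin_powr a t * (cos t * cos t - sin t * sin t)
        + a * sin_powr (a - 2) t * (sin t * cos t) * (sin t * cos t)
      = sin_powr a t * (1 - 2 * (sin t)\<^sup>2) + a * ((sin_powr (a - 2) t * (sin t)\<^sup>2) * (1 -
        (sin t)\<^sup>2))"
  proof -
    have c: "cos t * cos t = 1 - (sin t)\<^sup>2"
      using cos_squared_eq[of t] by (simp add: power2_eq_square)
    have "a * sin_powr (a - 2) t * (sin t * cos t) * (sin t * cos t)
        = a * ((sin_powr (a - 2) t * (sin t)\<^sup>2) * (cos t * cos t))"
      by (simp add: power2_eq_square)
    then show ?thesis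
      unfolding c by (simp add: power2_eq_square)
  qed
  moreover have "\<dots> = (a + 1) * sin_powr a t - (a + 2) * (sin_powr a t * (sin t)\<^sup>2)"
    unfolding sin_powr_mult_sin_square[of t "a - 2"] by (simp add: algebra_simps)
  ultimately show ?thesis
    unfolding sin_powr_mult_sin_square[of t a] by (simp only:)
qed

text \<open>The third derivative exists because \<open>p > 4\<close> keeps all exponents above \<open>1\<close> until the last
  differentiation. It is \<open>sin * cos\<close> times a difference of two functions with values in
  \<open>{0..p ^ 3}\<close>, so \<open>2 * p ^ 3\<close> bounds it, and \<open>2 / fact 3 \<le> 1\<close>.\<close>

lemma sin_powr_Taylor:
  assumes p: "p > 4"
  shows "\<bar>sin_powr p (t + h) - (sin_powr p t + p * sin_powr (p - 2) t * (sin t * cos t) * h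
      + p * ((p - 1) * sin_powr (p - 2) t - p * sin_powr p t) / 2 * h\<^sup>2)\<bar> \<le> p ^ 3 * \<bar>h\<bar> ^ 3"
proof -
  \<comment> \<open>\<open>D m\<close> is the \<open>m\<close>-th derivative in \<open>x\<close> of \<open>sin_powr p (t + x)\<close>, for \<open>m \<le> 3\<close>\<close>
  define D where "D = (\<lambda>(m::nat) x. if m = 0 then sin_powr p (t + x)
     else if m = 1 then p * (sin_powr (p - 2) (t + x) * (sin (t + x) * cos (t + x)))
     else if m = 2 then p * ((p - 1) * sin_powr (p - 2) (t + x) - p * sin_powr p (t + x))
     else p * ((p - 1) * (p - 2) * sin_powr (p - 4) (t + x) - p\<^sup>2 * sin_powr (p - 2) (t + x))
       * (sin (t + x) * cos (t + x)))"
  have sh: "((\<lambda>x. f (t + x)) has_real_derivative f') (at x)"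
    if "(f has_real_derivative f') (at (t + x))" for f f' x
    using that DERIV_shift[of f f' x t] by (simp add: add.commute)
  have 0: "(D 0 has_real_derivative D 1 x) (at x)" for x
    using sh[OF sin_powr_DERIV[of p "t + x"]] p by (simp add: D_def mult_ac)
  have 1: "(D 1 has_real_derivative D 2 x) (at x)" for x
    using sh[OF DERIV_cmult[OF sin_powr_sin_cos_DERIV[of "p - 2" "t + x"], of p]] p
    by (simp add: D_def)
  have 2: "(D 2 has_real_derivative D 3 x) (at x)" for x
    using sh[OF DERIV_cmult[OF DERIV_diff[OF DERIV_cmult[OF sin_powr_DERIV[of "p - 2" "t + x"], of
        "p - 1"]
        DERIV_cmult[OF sin_powr_DERIV[of p "t + x"], of p]], of p]] p
    by (simp add: D_def algebra_simps power2_eq_square)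
  have "\<exists>x. \<bar>x\<bar> \<le> \<bar>h\<bar> \<and> D 0 h = (\<Sum>m<3. D m 0 / fact m * h ^ m) + D 3 x / fact 3 * h ^ 3"
  proof (rule Maclaurin_bi_le)
    show "\<forall>m x. m < 3 \<and> \<bar>x\<bar> \<le> \<bar>h\<bar> \<longrightarrow> (D m has_real_derivative D (Suc m) x) (at x)"
      using 0 1 2 by (auto simp: less_Suc_eq numeral_2_eq_2 numeral_3_eq_3)
  qed simp
  then obtain x where x: "D 0 h = (\<Sum>m<3. D m 0 / fact m * h ^ m) + D 3 x / fact 3 * h ^ 3" by blast
  have "\<bar>D 3 x\<bar> \<le> 2 * p ^ 3"
  proof -
    let ?a = "(p - 1) * (p - 2) * sin_powr (p - 4) (t + x)"
    let ?b = "p\<^sup>2 * sin_powr (p - 2) (t + x)"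
    have pp: "(p - 1) * (p - 2) \<le> p * p" using p by (intro mult_mono) auto
    have "?a \<le> (p - 1) * (p - 2) * 1"
      using p by (intro mult_left_mono sin_powr_le_one) auto
    then have a1: "?a \<le> p\<^sup>2"
      using pp by (simp add: power2_eq_square)
    have a0: "0 \<le> ?a"
      using p by (intro mult_nonneg_nonneg) auto
    have b1: "?b \<le> p\<^sup>2 * 1"
      using p by (intro mult_left_mono sin_powr_le_one) auto
    have b0: "0 \<le> ?b"
      by simp
    have ab: "\<bar>?a - ?b\<bar> \<le> 2 * p\<^sup>2"
      using a0 a1 b0 b1 by linarith
    have sc: "\<bar>sin (t + x) * cos (t + x)\<bar> \<le> 1"
      using mult_mono[OF abs_sin_le_one[of "t + x"] abs_cos_le_one[of "t + x"]]
        by (simp add: abs_mult)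
    have "\<bar>D 3 x\<bar> = p * \<bar>?a - ?b\<bar> * \<bar>sin (t + x) * cos (t + x)\<bar>"
      using p by (simp add: D_def abs_mult)
    also have "\<dots> \<le> p * (2 * p\<^sup>2) * 1"
      using p ab sc by (intro mult_mono) auto
    finally show ?thesis by (simp add: power2_eq_square power3_eq_cube)
  qed
  moreover have "0 \<le> p ^ 3" using p by simp
  ultimately have "\<bar>D 3 x / 6\<bar> \<le> p ^ 3"
    unfolding abs_divide by simp
  then have "\<bar>D 3 x / fact 3 * h ^ 3\<bar> \<le> p ^ 3 * \<bar>h\<bar> ^ 3"
    unfolding abs_mult power_abs by (intro mult_right_mono) (auto simp: fact_numeral)
  then show ?thesis
    unfolding x[unfolded D_def, simplified] using x
    by (simp add: D_def eval_nat_numeral fact_numeral algebra_simps)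
qed

section \<open>The second variation in the direction of the third harmonic\<close>

lemma sin_triple: "sin (3 * t) = sin t * (3 - 4 * (sin t)\<^sup>2)" for t :: real
proof -
  have "sin (3 * t) = sin (2 * t + t)" by simp
  also have "\<dots> = 2 * sin t * (cos t)\<^sup>2 + (1 - 2 * (sin t)\<^sup>2) * sin t"
    by (simp only: sin_add sin_double cos_double_sin) (simp add: power2_eq_square)
  finally show ?thesis by (simp add: cos_squared_eq algebra_simps)
qed

text \<open>Division by \<open>(sin t)\<^sup>2\<close> does no harm: \<open>sin (3 * t)\<close> is \<open>sin t\<close> times a factor of absolute
  value at most \<open>3\<close>, so the quadratic term of the expansion contains \<open>(sin t)\<^sup>2\<close> and the cubic
  remainder even one power more. Every coefficient on the right is a continuous function of \<open>t\<close>. Where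
  \<open>sin t = 0\<close> the left side is \<open>0\<close> by the convention for division.\<close>

lemma energy_density_le:
  fixes p e t c :: real
  assumes p: "p > 4" and e: "e \<ge> 0" and c: "\<bar>c\<bar> \<le> 1"
  shows "sin_powr p (t + e * sin (3 * t) * c) / (sin t)\<^sup>2 \<le>
    sin_powr (p - 2) t + p * sin_powr (p - 2) t * cos t * (3 - 4 * (sin t)\<^sup>2) * e * c
      + p * ((p - 1) * sin_powr (p - 2) t - p * sin_powr p t) / 2 *
        (3 - 4 * (sin t)\<^sup>2)\<^sup>2 * e\<^sup>2 * c\<^sup>2
      + 27 * p ^ 3 * e ^ 3"
proof (cases "sin t = 0")
  case True
  then show ?thesis using p e by simp
next
  case False
  define S where "S = sin t"
  define h where "h = e * sin (3 * t) * c"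
  have h: "h = S * (3 - 4 * S\<^sup>2) * e * c"
    unfolding h_def sin_triple S_def by simp
  have S: "\<bar>S\<bar> \<le> 1" "S \<noteq> 0" "S\<^sup>2 \<le> 1" using False by (auto simp: S_def abs_square_le_1)
  have "\<bar>h\<bar> \<le> \<bar>S\<bar> * 3 * e * 1"
    unfolding h abs_mult using S e c by (intro mult_mono) (auto simp: abs_le_iff)
  then have "\<bar>h\<bar> ^ 3 \<le> (\<bar>S\<bar> * 3 * e) ^ 3" by (intro power_mono) auto
  also have "\<dots> = 27 * e ^ 3 * (S\<^sup>2 * \<bar>S\<bar>)"
    by (simp add: power_mult_distrib power3_eq_cube power2_eq_square)
  also have "\<dots> \<le> 27 * e ^ 3 * (S\<^sup>2 * 1)" using S e by (intro mult_left_mono) auto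
  finally have h3: "p ^ 3 * \<bar>h\<bar> ^ 3 \<le> p ^ 3 * (27 * e ^ 3 * S\<^sup>2)"
    using p by (intro mult_left_mono) auto
  have Sp: "sin_powr p t = sin_powr (p - 2) t * S\<^sup>2"
    using sin_powr_mult_sin_square[of t "p - 2"] by (simp add: S_def)
  have "sin_powr p (t + h) \<le> sin_powr p t + p * sin_powr (p - 2) t * (S * cos t) * h
      + p * ((p - 1) * sin_powr (p - 2) t - p * sin_powr p t) / 2 * h\<^sup>2
        + p ^ 3 * (27 * e ^ 3 * S\<^sup>2)"
    using sin_powr_Taylor[OF p, of t h] h3 unfolding S_def by linarith
  also have "\<dots> = S\<^sup>2 * (sin_powr (p - 2) t + p * sin_powr (p - 2) t * cos t * (3 - 4 * S\<^sup>2) * e * c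
      + p * ((p - 1) * sin_powr (p - 2) t - p * sin_powr p t) / 2 * (3 - 4 * S\<^sup>2)\<^sup>2 * e\<^sup>2 * c\<^sup>2
      + 27 * p ^ 3 * e ^ 3)"
    unfolding h Sp by (simp add: field_simps power2_eq_square)
  finally show ?thesis
    using S by (simp add: S_def h_def divide_le_eq mult.commute)
qed

text \<open>With \<open>S = (sin t)\<^sup>2\<close> the integrand is \<open>sin_powr (p - 2) t\<close> times a cubic polynomial in \<open>S\<close>.
  Subtracting multiples of the exact derivatives from \<open>sin_powr_sin_cos_DERIV\<close> for the exponents
  \<open>p - 2\<close>, \<open>p\<close> and \<open>p + 2\<close>, with coefficients \<open>9\<close>, \<open>b\<close> and \<open>c\<close>, removes all powers but
  \<open>sin_powr p\<close>; the primitives vanish at both ends of the period, so only the coefficient \<open>\<kappa>\<close> of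
  \<open>sin_powr p\<close> survives.\<close>

lemma second_variation_has_integral:
  assumes p: "p > 4"
  defines "J \<equiv> integral {0..2 * pi} (\<lambda>d. sin_powr p (d / 2))"
  shows "((\<lambda>d. ((p - 1) * sin_powr (p - 2) (d / 2) - p * sin_powr p (d / 2))
      * (3 - 4 * (sin (d / 2))\<^sup>2)\<^sup>2)
     has_integral 16 * (8 - p) / ((p + 2) * (p + 4)) * J) {0..2 * pi}"
proof -
  define \<kappa> where "\<kappa> = 16 * (8 - p) / ((p + 2) * (p + 4))"
  \<comment> \<open>\<open>c\<close> matches the coefficient of \<open>sin_powr (p + 4)\<close>, then \<open>b\<close> that of \<open>sin_powr (p + 2)\<close>\<close>
  define c where "c = 16 * p / (p + 4)"
  define b where "b = (c * (p + 3) - 40 * p + 16) / (p + 2)"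
  define F where "F = (\<lambda>a t. sin_powr a t * (sin t * cos t))"
  define F' where "F' = (\<lambda>a t. (a + 1) * sin_powr a t - (a + 2) * sin_powr (a + 2) t)"
  have c: "c * (p + 4) = 16 * p" and b: "b * (p + 2) = c * (p + 3) - 40 * p + 16"
    using p by (simp_all add: c_def b_def)
  have "\<kappa> * ((p + 2) * (p + 4)) = 16 * (8 - p)"
    using p by (simp add: \<kappa>_def)
  moreover have "(24 - 24 * p - b * (p + 1)) * ((p + 2) * (p + 4)) = 16 * (8 - p)"
    using b c by algebra
  moreover have nz: "(p + 2) * (p + 4) \<noteq> 0"
    using p by simp
  ultimately have \<kappa>: "\<kappa> + b * (p + 1) = 24 - 24 * p"
    using p
    by (metis diff_add_cancel mult_right_cancel nz)
  have decomp: "((p - 1) * sin_powr (p - 2) t - p * sin_powr p t) * (3 - 4 * (sin t)\<^sup>2)\<^sup>2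
      = \<kappa> * sin_powr p t + (9 * F' (p - 2) t + b * F' p t + c * F' (p + 2) t)" for t
  proof -
    define s where "s = sin_powr (p - 2) t"
    define S where "S = (sin t)\<^sup>2"
    have s0: "sin_powr p t = s * S" and s2: "sin_powr (p + 2) t = s * S * S"
      and s4: "sin_powr (p + 4) t = s * S * S * S"
      using sin_powr_mult_sin_square[of t "p - 2"] sin_powr_mult_sin_square[of t "p"]
        sin_powr_mult_sin_square[of t "p + 2"]
      by (simp_all add: s_def S_def add.assoc)
    have F': "F' (p - 2) t = (p - 1) * s - p * (s * S)"
      "F' p t = (p + 1) * (s * S) - (p + 2) * (s * S * S)"
      "F' (p + 2) t = (p + 3) * (s * S * S) - (p + 4) * (s * S * S * S)"
      unfolding F'_def using s0 s2 s4 by (simp_all add: s_def add.assoc)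
    have "\<kappa> * (s * S) + (9 * F' (p - 2) t + b * F' p t + c * F' (p + 2) t)
        = 9 * (p - 1) * s + (\<kappa> + b * (p + 1) - 9 * p) * (s * S)
          + (c * (p + 3) - b * (p + 2)) * (s * S * S) - c * (p + 4) * (s * S * S * S)"
      unfolding F' by (simp add: algebra_simps)
    also have "\<dots> = 9 * (p - 1) * s + (24 - 24 * p - 9 * p) * (s * S)
          + (40 * p - 16) * (s * S * S) - 16 * p * (s * S * S * S)"
      unfolding \<kappa> b c by simp
    also have "\<dots> = ((p - 1) * s - p * (s * S)) * (3 - 4 * S)\<^sup>2"
      by (simp add: algebra_simps power2_eq_square)
    finally show ?thesis
      by (simp only: s0 s_def[symmetric] S_def[symmetric])
  qed
  have "((\<lambda>d. 9 * F' (p - 2) (d / 2) + b * F' p (d / 2) + c * F' (p + 2) (d / 2)) has_integral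
     2 * (9 * F (p - 2) (2 * pi / 2) + b * F p (2 * pi / 2) + c * F (p + 2) (2 * pi / 2))
     - 2 * (9 * F (p - 2) (0 / 2) + b * F p (0 / 2) + c * F (p + 2) (0 / 2))) {0..2 * pi}"
  proof (rule fundamental_theorem_of_calculus)
    have F: "((\<lambda>d. F a (d / 2)) has_real_derivative F' a (d / 2) / 2) (at d within A)" if "a > 1"
      for a d A
      using DERIV_chain2[OF sin_powr_sin_cos_DERIV[OF that, of "d / 2"]
        DERIV_cdivide[OF DERIV_ident, of 2]]
      by (simp add: F_def F'_def has_field_derivative_at_within)
    show "((\<lambda>d. 2 * (9 * F (p - 2) (d / 2) + b * F p (d / 2) + c * F (p + 2) (d / 2)))
      has_vector_derivative
      9 * F' (p - 2) (d / 2) + b * F' p (d / 2) + c * F' (p + 2) (d / 2)) (at d within {0..2 * pi})"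
        for d
      unfolding has_real_derivative_iff_has_vector_derivative[symmetric]
      using p by (auto intro!: derivative_eq_intros F)
  qed simp
  then have "((\<lambda>d. 9 * F' (p - 2) (d / 2) + b * F' p (d / 2) + c * F' (p + 2) (d / 2))
    has_integral 0) {0..2 * pi}"
    by (simp add: F_def)
  moreover have "((\<lambda>d. sin_powr p (d / 2)) has_integral J) {0..2 * pi}"
    unfolding J_def using p
      by (intro integrable_integral integrable_continuous_real continuous_intros) auto
  ultimately have "((\<lambda>d. \<kappa> * sin_powr p (d / 2) + (9 * F' (p - 2) (d / 2) + b * F' p (d / 2)
    + c * F' (p + 2) (d / 2)))
      has_integral \<kappa> * J + 0) {0..2 * pi}"
    by (intro has_integral_add has_integral_mult_right)
  then show ?thesis
    by (simp only: decomp \<kappa>_def[symmetric] add_0_right)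
qed

lemma integral_sin_powr_pos:
  assumes p: "p > 0"
  shows "integral {0..2 * pi} (\<lambda>d. sin_powr p (d / 2)) > 0"
proof -
  have "integral {0..2 * pi} (\<lambda>d. sin_powr p (d / 2)) \<noteq> 0"
  proof (subst integral_eq_0_iff)
    show "continuous_on {0..2 * pi} (\<lambda>d. sin_powr p (d / 2))"
      using p by (intro continuous_intros) auto
    show "\<not> (\<forall>x\<in>{0..2 * pi}. sin_powr p (x / 2) = 0)"
      by (auto intro!: bexI[of _ pi])
  qed auto
  moreover have "integral {0..2 * pi} (\<lambda>d. sin_powr p (d / 2)) \<ge> 0"
    by (rule integral_nonneg) (use p in \<open>auto intro!: integrable_continuous_real continuous_intros\<close>)
  ultimately show ?thesis by simp
qed

section \<open>Energy of the perturbed identity\<close>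

text \<open>The map \<open>cis \<theta> \<mapsto> cis (\<theta> + \<epsilon> * sin (3 * \<theta>))\<close>, expressed through
  \<open>Im (x ^ 3) = sin (3 * \<theta>)\<close> so that continuity is evident without a choice of argument.\<close>

definition wiggle :: "real \<Rightarrow> complex \<Rightarrow> complex"
  where "wiggle \<epsilon> x = x * cis (\<epsilon> * Im (x ^ 3))"

lemma wiggle_cis: "wiggle \<epsilon> (cis a) = cis (a + \<epsilon> * sin (3 * a))"
  by (simp add: wiggle_def Complex.DeMoivre cis_mult)

lemma wiggle_0 [simp]: "wiggle 0 = (\<lambda>x. x)"
  by (auto simp: wiggle_def)

lemma continuous_on_wiggle [continuous_intros]: "continuous_on A (wiggle \<epsilon>)"
  unfolding wiggle_def by (intro continuous_intros)

lemma norm_cis_diff: "norm (cis a - cis b) = 2 * \<bar>sin ((a - b) / 2)\<bar>"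
proof -
  have "(norm (cis a - cis b))\<^sup>2 = 2 - 2 * cos (a - b)"
    by (simp add: cmod_power2 cos_diff power2_diff sin_squared_eq algebra_simps)
  also have "\<dots> = (2 * \<bar>sin ((a - b) / 2)\<bar>)\<^sup>2"
  proof -
    have "2 * ((a - b) / 2) = a - b" by simp
    then have "cos (a - b) = 1 - 2 * (sin ((a - b) / 2))\<^sup>2"
      using cos_double_sin[of "(a - b) / 2"] by (simp only:)
    then show ?thesis by (simp add: power_mult_distrib)
  qed
  finally show ?thesis
    by (rule power2_eq_imp_eq) auto
qed

lemma energy_wiggle:
  assumes s: "s > 0"
  defines "p \<equiv> 1 / s"
  shows "energy s (wiggle \<epsilon>) = (\<integral>\<^sup>+d\<in>{0..<2 * pi}. (\<integral>\<^sup>+m\<in>{0..<2 * pi}.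
     ennreal (2 powr p / 4 * (sin_powr p
       (d / 2 + \<epsilon> * sin (3 * (d / 2)) * cos (3 * m)) / (sin (d / 2))\<^sup>2)) \<partial>lborel) \<partial>lborel)"
proof -
  have [measurable]: "wiggle \<epsilon> \<in> borel_measurable borel"
    by (intro borel_measurable_continuous_onI continuous_intros)
  have *: "norm (wiggle \<epsilon> (cis (m + d / 2)) - wiggle \<epsilon> (cis (m - d / 2))) powr p
      / (norm (cis (m + d / 2) - cis (m - d / 2)))\<^sup>2
     = 2 powr p / 4 * (sin_powr p (d / 2 + \<epsilon> * sin (3 * (d / 2)) * cos (3 * m)) / (sin (d / 2))\<^sup>2)"
       for m d
  proof -
    have "sin (3 * (m + d / 2)) - sin (3 * (m - d / 2)) = 2 * sin (3 * (d / 2)) * cos (3 * m)"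
      by (simp add: distrib_left right_diff_distrib sin_add sin_diff)
    then have arg: "(m + d / 2 + \<epsilon> * sin (3 * (m + d / 2)) - (m - d / 2
      + \<epsilon> * sin (3 * (m - d / 2)))) / 2
      = d / 2 + \<epsilon> * sin (3 * (d / 2)) * cos (3 * m)"
      by (simp add: field_simps)
    have arg': "(m + d / 2 - (m - d / 2)) / 2 = d / 2" by simp
    show ?thesis
      unfolding wiggle_cis norm_cis_diff arg arg' by (simp add: powr_mult power_mult_distrib)
  qed
  show ?thesis
    unfolding energy_def p_def[symmetric]
    by (subst nn_integral_arclength_pair_difference) (measurable, simp add: *)
qed

lemma set_nn_integral_Ico_le:
  fixes f :: "real \<Rightarrow> ennreal" and g :: "real \<Rightarrow> real"
  assumes "\<And>x. x \<in> {a..b} \<Longrightarrow> 0 \<le> g x" "\<And>x. x \<in> {a..b} \<Longrightarrow> f x \<le> ennreal (g x)"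
    and "(g has_integral I) {a..b}"
  shows "(\<integral>\<^sup>+x\<in>{a..<b}. f x \<partial>lborel) \<le> ennreal I"
proof -
  have "(\<integral>\<^sup>+x\<in>{a..<b}. f x \<partial>lborel) \<le> (\<integral>\<^sup>+x\<in>{a..b}. ennreal (g x) \<partial>lborel)"
    using assms(2) by (intro nn_integral_mono) (auto simp: indicator_def)
  also have "\<dots> = ennreal I"
    using assms(1,3) by (rule nn_integral_has_integral_lebesgue')
  finally show ?thesis .
qed

lemma set_nn_integral_Ico_eq:
  fixes g :: "real \<Rightarrow> real"
  assumes "\<And>x. x \<in> {a..b} \<Longrightarrow> 0 \<le> g x" and "(g has_integral I) {a..b}"
  shows "(\<integral>\<^sup>+x\<in>{a..<b}. ennreal (g x) \<partial>lborel) = ennreal I"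
proof -
  have "(\<integral>\<^sup>+x\<in>{a..<b}. ennreal (g x) \<partial>lborel) = (\<integral>\<^sup>+x\<in>{a..b}. ennreal (g x) \<partial>lborel)"
    by (rule nn_integral_cong_AE)
       (use AE_lborel_singleton[of b] in \<open>eventually_elim, auto simp: indicator_def\<close>)
  also have "\<dots> = ennreal I"
    using assms by (rule nn_integral_has_integral_lebesgue')
  finally show ?thesis .
qed

lemma energy_identity:
  assumes s: "0 < s" "s < 1 / 2"
  defines "p \<equiv> 1 / s"
  shows "energy s (\<lambda>x. x) = ennreal (2 powr p / 4 * (2 * pi * integral {0..2 * pi}
    (\<lambda>d. sin_powr (p - 2) (d / 2))))"
proof -
  have p: "p > 2" using s by (simp add: p_def field_simps)
  have *: "sin_powr p t / (sin t)\<^sup>2 = sin_powr (p - 2) t" for t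
    using sin_powr_mult_sin_square[of t "p - 2"] by (cases "sin t = 0") (auto simp: field_simps)
  have "energy s (\<lambda>x. x) = (\<integral>\<^sup>+d\<in>{0..<2 * pi}. (\<integral>\<^sup>+m\<in>{0..<2 * pi}.
    ennreal (2 powr p / 4 * sin_powr (p - 2) (d / 2)) \<partial>lborel) \<partial>lborel)"
    using energy_wiggle[OF s(1), of 0] by (simp add: p_def[symmetric] *)
  also have "\<dots> = (\<integral>\<^sup>+d\<in>{0..<2 * pi}. ennreal (2 powr p / 4 * (2 * pi *
    sin_powr (p - 2) (d / 2))) \<partial>lborel)"
    by (intro nn_integral_cong, subst nn_integral_cmult_indicator)
       (auto simp flip: ennreal_mult'' simp: mult.assoc mult.commute[of _ "2 * pi"]
         mult.left_commute[of _ "2 * pi"])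
  also have "\<dots> = ennreal (2 powr p / 4 * (2 * pi * integral {0..2 * pi}
    (\<lambda>d. sin_powr (p - 2) (d / 2))))"
    using p by (intro set_nn_integral_Ico_eq has_integral_mult_right integrable_integral
      integrable_continuous_real continuous_intros) auto
  finally show ?thesis .
qed

text \<open>Integrate \<open>energy_density_le\<close> first in the mean angle: \<open>cos (3 * m)\<close> integrates to \<open>0\<close> over a
  period, which removes the first variation, and its square to \<open>pi\<close>. The remaining integral in \<open>d\<close>
  is the second variation.\<close>

lemma energy_wiggle_le:
  assumes s: "0 < s" "s < 1 / 4" and \<epsilon>: "\<epsilon> \<ge> 0"
  defines "p \<equiv> 1 / s"
  defines "J \<equiv> integral {0..2 * pi} (\<lambda>d. sin_powr p (d / 2))"
  shows "energy s (wiggle \<epsilon>) \<le> ennreal (2 powr p / 4 *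
     (2 * pi * integral {0..2 * pi} (\<lambda>d. sin_powr (p - 2) (d / 2))
      + pi * p / 2 * \<epsilon>\<^sup>2 * (16 * (8 - p) / ((p + 2) * (p + 4)) * J)
        + 27 * (2 * pi)\<^sup>2 * p ^ 3 * \<epsilon> ^ 3))"
proof -
  have p: "p > 4" using s by (simp add: p_def field_simps)
  define K where "K = 2 powr p / (4::real)"
  have K: "K \<ge> 0" by (simp add: K_def)
  define A where "A = (\<lambda>d. sin_powr (p - 2) (d / 2))"
  define B where "B = (\<lambda>d. p * sin_powr (p - 2) (d / 2) * cos (d / 2) *
    (3 - 4 * (sin (d / 2))\<^sup>2) * \<epsilon>)"
  define Q where "Q = (\<lambda>d. ((p - 1) * sin_powr (p - 2) (d / 2) - p * sin_powr p (d / 2)) *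
    (3 - 4 * (sin (d / 2))\<^sup>2)\<^sup>2)"
  define M where "M = 27 * p ^ 3 * \<epsilon> ^ 3"
  define dens where "dens = (\<lambda>d m. sin_powr p
    (d / 2 + \<epsilon> * sin (3 * (d / 2)) * cos (3 * m)) / (sin (d / 2))\<^sup>2)"
  have dens0: "0 \<le> dens d m" for d m
    by (simp add: dens_def)
  have le: "dens d m \<le> A d + B d * cos (3 * m) + p / 2 * \<epsilon>\<^sup>2 * Q d * (cos (3 * m))\<^sup>2 + M" for d m
    using energy_density_le[OF p \<epsilon>, of "cos (3 * m)" "d / 2"]
    unfolding dens_def A_def B_def Q_def M_def by (simp add: mult_ac)
  have cos1: "((\<lambda>m. cos (3 * m)) has_integral 0) {0..2 * pi}"
  proof -
    have "((\<lambda>m. cos (3 * m)) has_integral sin (3 * (2 * pi)) / 3 - sin (3 * 0) / 3) {0..2 * pi}"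
      by (rule fundamental_theorem_of_calculus)
         (auto intro!: derivative_eq_intros simp:
           has_real_derivative_iff_has_vector_derivative[symmetric])
    moreover have "sin (3 * (2 * pi)) = 0"
      using sin_2npi[of 3] by (simp add: mult_ac)
    ultimately show ?thesis by simp
  qed
  have cos2: "((\<lambda>m. (cos (3 * m))\<^sup>2) has_integral pi) {0..2 * pi}"
  proof -
    define F where "F = (\<lambda>m::real. m / 2 + sin (6 * m) / 12)"
    have "((\<lambda>m. (cos (3 * m))\<^sup>2) has_integral F (2 * pi) - F 0) {0..2 * pi}"
    proof (rule fundamental_theorem_of_calculus)
      show "(F has_vector_derivative (cos (3 * m))\<^sup>2) (at m within {0..2 * pi})" for m
      proof -
        have "cos (6 * m) = 2 * (cos (3 * m))\<^sup>2 - 1"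
          using cos_double_cos[of "3 * m"] by simp
        then show ?thesis
          unfolding F_def has_real_derivative_iff_has_vector_derivative[symmetric]
          by (auto intro!: derivative_eq_intros simp: field_simps)
      qed
    qed simp
    moreover have "sin (6 * (2 * pi)) = 0"
      using sin_2npi[of 6] by (simp add: mult_ac)
    ultimately show ?thesis by (simp add: F_def)
  qed
  define G where "G = (\<lambda>d. K * (2 * pi * A d + pi * p / 2 * \<epsilon>\<^sup>2 * Q d + 2 * pi * M))"
  have G: "((\<lambda>m. K * (A d + B d * cos (3 * m) + p / 2 * \<epsilon>\<^sup>2 * Q d * (cos (3 * m))\<^sup>2 + M))
    has_integral G d) {0..2 * pi}" for d
  proof -
    have "((\<lambda>m. K * (A d + B d * cos (3 * m) + p / 2 * \<epsilon>\<^sup>2 * Q d * (cos (3 * m))\<^sup>2 + M))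
      has_integral K * ((2 * pi - 0) * A d + B d * 0 + p / 2 * \<epsilon>\<^sup>2 * Q d * pi
        + (2 * pi - 0) * M)) {0..2 * pi}"
      using has_integral_const_real[of "A d" 0 "2 * pi"] has_integral_const_real[of M 0 "2 * pi"]
      by (intro has_integral_mult_right has_integral_add cos1 cos2) auto
    then show ?thesis by (simp add: G_def algebra_simps)
  qed
  have bound0: "0 \<le> K * (A d + B d * cos (3 * m) + p / 2 * \<epsilon>\<^sup>2 * Q d * (cos (3 * m))\<^sup>2 + M)" for d m
    using order_trans[OF dens0 le] K by simp
  have G0: "0 \<le> G d" for d
    using has_integral_nonneg[OF G bound0] .
  have "energy s (wiggle \<epsilon>) = (\<integral>\<^sup>+d\<in>{0..<2 * pi}. (\<integral>\<^sup>+m\<in>{0..<2 * pi}.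
    ennreal (K * dens d m) \<partial>lborel) \<partial>lborel)"
    using energy_wiggle[OF s(1), of \<epsilon>] unfolding K_def dens_def p_def .
  also have "\<dots> \<le> ennreal (K * (2 * pi * integral {0..2 * pi} A
    + pi * p / 2 * \<epsilon>\<^sup>2 * (16 * (8 - p) / ((p + 2) * (p + 4)) * J) + (2 * pi - 0) * (2 * pi * M)))"
  proof (rule set_nn_integral_Ico_le[where g = G])
    show "(\<integral>\<^sup>+m\<in>{0..<2 * pi}. ennreal (K * dens d m) \<partial>lborel) \<le> ennreal (G d)" for d
      by (rule set_nn_integral_Ico_le[OF bound0 _ G]) (intro ennreal_leI mult_left_mono le K)
    have "(A has_integral integral {0..2 * pi} A) {0..2 * pi}"
      unfolding A_def using p
        by (intro integrable_integral integrable_continuous_real continuous_intros) auto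
    moreover have "(Q has_integral (16 * (8 - p) / ((p + 2) * (p + 4)) * J)) {0..2 * pi}"
      unfolding Q_def J_def by (rule second_variation_has_integral[OF p])
    ultimately show "(G has_integral K * (2 * pi * integral {0..2 * pi} A
      + pi * p / 2 * \<epsilon>\<^sup>2 * (16 * (8 - p) / ((p + 2) * (p + 4)) * J)
        + (2 * pi - 0) * (2 * pi * M))) {0..2 * pi}"
      using has_integral_const_real[of "2 * pi * M" 0 "2 * pi"]
      unfolding G_def by (intro has_integral_mult_right has_integral_add) auto
  qed (rule G0)
  also have "K * (2 * pi * integral {0..2 * pi} A + pi * p / 2 * \<epsilon>\<^sup>2 * (16 * (8 - p)
    / ((p + 2) * (p + 4)) * J) + (2 * pi - 0) * (2 * pi * M))
    = 2 powr p / 4 * (2 * pi * integral {0..2 * pi} (\<lambda>d. sin_powr (p - 2) (d / 2))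
      + pi * p / 2 * \<epsilon>\<^sup>2 * (16 * (8 - p) / ((p + 2) * (p + 4)) * J)
        + 27 * (2 * pi)\<^sup>2 * p ^ 3 * \<epsilon> ^ 3)"
    unfolding K_def A_def M_def by (simp add: power2_eq_square)
  finally show ?thesis .
qed

text \<open>The gain \<open>a * \<epsilon>\<^sup>2\<close> from the negative second variation outweighs the error \<open>b * \<epsilon> ^ 3\<close> as soon
  as \<open>\<epsilon> < a / b\<close>.\<close>

lemma energy_wiggle_less:
  assumes s: "0 < s" "s < 1 / 8"
  shows "\<forall>\<^sub>F \<epsilon> in at_right 0. energy s (wiggle \<epsilon>) < energy s (\<lambda>x. x)"
proof -
  define p where "p = 1 / s"
  have p: "p > 8" using s by (simp add: p_def field_simps)
  define J where "J = integral {0..2 * pi} (\<lambda>d. sin_powr p (d / 2))"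
  have J: "J > 0" unfolding J_def by (rule integral_sin_powr_pos) (use p in simp)
  define a where "a = - (pi * p / 2 * (16 * (8 - p) / ((p + 2) * (p + 4)) * J))"
  define b where "b = 27 * (2 * pi)\<^sup>2 * p ^ 3"
  have a: "a > 0"
    unfolding a_def neg_0_less_iff_less using p J
      by (intro mult_pos_neg mult_neg_pos divide_neg_pos) auto
  have b: "b > 0" unfolding b_def using p by (intro mult_pos_pos) auto
  define I where "I = integral {0..2 * pi} (\<lambda>d. sin_powr (p - 2) (d / 2))"
  have I: "I > 0" unfolding I_def by (rule integral_sin_powr_pos) (use p in simp)
  have "energy s (wiggle \<epsilon>) < energy s (\<lambda>x. x)" if \<epsilon>: "0 < \<epsilon>" "\<epsilon> < a / b" for \<epsilon>
  proof -
    have "b * \<epsilon> < a" using \<epsilon> b by (simp add: pos_less_divide_eq mult.commute)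
    then have "\<epsilon>\<^sup>2 * (b * \<epsilon>) < \<epsilon>\<^sup>2 * a" using \<epsilon> by (intro mult_strict_left_mono) auto
    then have less: "2 * pi * I - a * \<epsilon>\<^sup>2 + b * \<epsilon> ^ 3 < 2 * pi * I"
      by (simp add: power2_eq_square power3_eq_cube mult_ac)
    have "pi * p / 2 * \<epsilon>\<^sup>2 * (16 * (8 - p) / ((p + 2) * (p + 4)) * J) = - a * \<epsilon>\<^sup>2"
      by (simp add: a_def)
    then have "energy s (wiggle \<epsilon>) \<le> ennreal (2 powr p / 4 * (2 * pi * I - a * \<epsilon>\<^sup>2 + b * \<epsilon> ^ 3))"
      using energy_wiggle_le[of s \<epsilon>] s \<epsilon>
        unfolding p_def[symmetric] I_def[symmetric] J_def[symmetric] b_def by simp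
    also have "\<dots> < ennreal (2 powr p / 4 * (2 * pi * I))"
      using less I by (intro ennreal_lessI mult_strict_left_mono) auto
    also have "\<dots> = energy s (\<lambda>x. x)"
      using energy_identity[of s] s unfolding p_def[symmetric] I_def[symmetric] by simp
    finally show ?thesis .
  qed
  moreover have "\<forall>\<^sub>F \<epsilon> in at_right 0. \<epsilon> \<in> {0<..<a / b}"
    using a b by (intro eventually_at_right_real) auto
  ultimately show ?thesis
    by (auto elim: eventually_mono)
qed

section \<open>Lipschitz bounds and the Sobolev seminorm\<close>

text \<open>The integrand is at most \<open>L powr p * norm (x - y) powr (p - 2)\<close> with \<open>p = 1 / s\<close>, which is
  bounded on the circle since \<open>p > 2\<close>.\<close>

lemma gagliardo_seminorm_Lipschitz:
  fixes f :: "complex \<Rightarrow> complex"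
  assumes s: "0 < s" "s < 1 / 2" and L: "L \<ge> 0"
    and lip: "\<And>x y. x \<in> unit_circle \<Longrightarrow> y \<in> unit_circle \<Longrightarrow> norm (f x - f y) \<le> L * norm (x - y)"
  shows "gagliardo_seminorm s (1 / s) f \<le> ennreal (L * (2 powr (1 / s - 2) * (2 * pi)\<^sup>2) powr s)"
proof -
  define p where "p = 1 / s"
  have p: "p > 2" and sp: "s * p = 1" using s by (auto simp: p_def field_simps)
  interpret finite_measure arclength by (rule finite_measure_arclength)
  have sp': "space arclength = unit_circle"
    by (simp add: arclength_def space_restrict_space)
  have "emeasure arclength (space arclength) = (\<integral>\<^sup>+\<theta>\<in>{0..<2 * pi}. 1 \<partial>lborel)"
    using nn_integral_arclength[of "\<lambda>_. 1"] by simp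
  then have mass: "emeasure arclength (space arclength) = ennreal (2 * pi)"
    by simp
  have pt: "norm (f x - f y) powr p / norm (x - y) powr (1 + s * p) \<le> L powr p * 2 powr (p - 2)"
    if xy: "x \<in> unit_circle" "y \<in> unit_circle" for x y
  proof (cases "x = y")
    case False
    have "norm (f x - f y) powr p \<le> (L * norm (x - y)) powr p"
      using lip[OF xy] p by (intro powr_mono2) auto
    then have "norm (f x - f y) powr p / norm (x - y) powr 2
      \<le> L powr p * norm (x - y) powr p / norm (x - y) powr 2"
      using L by (simp add: powr_mult divide_right_mono)
    also have "\<dots> = L powr p * norm (x - y) powr (p - 2)"
      by (simp add: powr_diff)
    also have "norm (x - y) powr (p - 2) \<le> 2 powr (p - 2)"
      using norm_triangle_ineq4[of x y] xy p by (intro powr_mono2) auto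
    finally show ?thesis
      by (simp add: sp mult_left_mono)
  qed simp
  have "gagliardo_integral s p f \<le> (\<integral>\<^sup>+z. ennreal (L powr p
    * 2 powr (p - 2)) \<partial>(arclength \<Otimes>\<^sub>M arclength))"
    unfolding gagliardo_integral_def
    by (intro nn_integral_mono) (auto simp: space_pair_measure sp' intro!: ennreal_leI pt)
  also have "\<dots> = ennreal (L powr p * 2 powr (p - 2)) * (ennreal (2 * pi) * ennreal (2 * pi))"
    by (simp add: space_pair_measure emeasure_pair_measure_Times mass)
  also have "\<dots> = ennreal (L powr p * (2 powr (p - 2) * (2 * pi)\<^sup>2))"
    by (simp add: power2_eq_square mult.assoc flip: ennreal_mult'')
  finally have le: "gagliardo_integral s p f \<le> ennreal (L powr p * (2 powr (p - 2) * (2 * pi)\<^sup>2))" .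
  then have "enn2real (gagliardo_integral s p f) \<le> L powr p * (2 powr (p - 2) * (2 * pi)\<^sup>2)"
    by (intro enn2real_leI) auto
  then have "enn2real (gagliardo_integral s p f) powr (1 / p)
    \<le> (L powr p * (2 powr (p - 2) * (2 * pi)\<^sup>2)) powr (1 / p)"
    using p by (intro powr_mono2) auto
  also have "\<dots> = L * (2 powr (p - 2) * (2 * pi)\<^sup>2) powr s"
    using L p s by (simp add: powr_mult powr_powr p_def)
  finally show ?thesis
    using le unfolding gagliardo_seminorm_def p_def by (auto simp: top_unique intro: ennreal_leI)
qed

lemma norm_cis_diff_le: "norm (cis a - cis b) \<le> \<bar>a - b\<bar>"
  using abs_sin_x_le_abs_x[of "(a - b) / 2"] by (simp add: norm_cis_diff)

lemma norm_wiggle [simp]: "norm (wiggle \<epsilon> x) = norm x"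
  by (simp add: wiggle_def norm_mult)

lemma abs_Im_cube_le: "x \<in> unit_circle \<Longrightarrow> \<bar>Im (x ^ 3)\<bar> \<le> 1"
  using abs_Im_le_cmod[of "x ^ 3"] by (simp add: norm_power)

text \<open>Split the increment according to which factor of
  \<open>x * (cis (\<epsilon> * Im (x ^ 3)) - 1)\<close> varies: the first contributes \<open>\<epsilon>\<close> to the
  constant, the second \<open>3 * \<epsilon>\<close> because cubing is \<open>3\<close>-Lipschitz on the circle.\<close>

lemma wiggle_minus_id_Lipschitz:
  assumes x: "x \<in> unit_circle" and y: "y \<in> unit_circle" and e: "\<epsilon> \<ge> 0"
  shows "norm ((wiggle \<epsilon> x - x) - (wiggle \<epsilon> y - y)) \<le> 4 * \<epsilon> * norm (x - y)"
proof -
  define a where "a = Im (x ^ 3)"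
  define b where "b = Im (y ^ 3)"
  have "\<bar>a - b\<bar> \<le> norm (x ^ 3 - y ^ 3)"
    using abs_Im_le_cmod[of "x ^ 3 - y ^ 3"] by (simp add: a_def b_def)
  also have "x ^ 3 - y ^ 3 = (x - y) * (x * x + x * y + y * y)"
    by (simp add: algebra_simps power3_eq_cube)
  also have "norm \<dots> \<le> norm (x - y) * 3"
    unfolding norm_mult
    by (intro mult_left_mono norm_triangle_le) (use x y in \<open>auto simp: norm_mult
      intro!: norm_triangle_le\<close>)
  finally have ab: "\<bar>a - b\<bar> \<le> 3 * norm (x - y)" by simp
  have "norm (cis (\<epsilon> * a) - 1) \<le> \<epsilon> * 1"
    using norm_cis_diff_le[of "\<epsilon> * a" 0] e mult_left_mono[OF abs_Im_cube_le[OF x] e]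
      by (simp add: abs_mult a_def)
  then have 1: "norm ((x - y) * (cis (\<epsilon> * a) - 1)) \<le> norm (x - y) * \<epsilon>"
    unfolding norm_mult by (intro mult_left_mono) auto
  have "norm (cis (\<epsilon> * a) - cis (\<epsilon> * b)) \<le> \<bar>\<epsilon> * a - \<epsilon> * b\<bar>"
    by (rule norm_cis_diff_le)
  also have "\<dots> \<le> \<epsilon> * (3 * norm (x - y))"
    using mult_left_mono[OF ab e] e by (simp add: abs_mult flip: right_diff_distrib)
  finally have 2: "norm (y * (cis (\<epsilon> * a) - cis (\<epsilon> * b))) \<le> \<epsilon> * (3 * norm (x - y))"
    using y by (simp add: norm_mult)
  have "(wiggle \<epsilon> x - x) - (wiggle \<epsilon> y - y) = (x - y) * (cis (\<epsilon> * a) - 1)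
    + y * (cis (\<epsilon> * a) - cis (\<epsilon> * b))"
    by (simp add: wiggle_def a_def b_def algebra_simps)
  also have "norm \<dots> \<le> norm (x - y) * \<epsilon> + \<epsilon> * (3 * norm (x - y))"
    using 1 2 by (rule norm_triangle_mono)
  finally show ?thesis by simp
qed

lemma norm_wiggle_minus_id_le:
  assumes "x \<in> unit_circle" "\<epsilon> \<ge> 0"
  shows "norm (wiggle \<epsilon> x - x) \<le> \<epsilon>"
proof -
  have "wiggle \<epsilon> x - x = x * (cis (\<epsilon> * Im (x ^ 3)) - cis 0)"
    by (simp add: wiggle_def algebra_simps)
  then have "norm (wiggle \<epsilon> x - x) \<le> \<bar>\<epsilon> * Im (x ^ 3)\<bar>"
    using assms norm_cis_diff_le[of "\<epsilon> * Im (x ^ 3)" 0] by (simp add: norm_mult del: cis_zero)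
  also have "\<dots> \<le> \<epsilon> * 1"
    using assms mult_left_mono[OF abs_Im_cube_le, of x \<epsilon>] by (simp add: abs_mult)
  finally show ?thesis by simp
qed

lemma wiggle_Lipschitz:
  assumes "x \<in> unit_circle" "y \<in> unit_circle" "\<epsilon> \<ge> 0"
  shows "norm (wiggle \<epsilon> x - wiggle \<epsilon> y) \<le> (4 * \<epsilon> + 1) * norm (x - y)"
  using norm_triangle_le[of "(wiggle \<epsilon> x - x) - (wiggle \<epsilon> y - y)" "x - y"
    "(4 * \<epsilon> + 1) * norm (x - y)"]
    wiggle_minus_id_Lipschitz[OF assms] by (simp add: algebra_simps)

lemma wiggle_in_sobolev_circle_maps:
  assumes s: "0 < s" "s < 1 / 2" and e: "\<epsilon> \<ge> 0"
  shows "wiggle \<epsilon> \<in> sobolev_circle_maps s"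
proof -
  have "gagliardo_seminorm s (1 / s) (wiggle \<epsilon>)
    \<le> ennreal ((4 * \<epsilon> + 1) * (2 powr (1 / s - 2) * (2 * pi)\<^sup>2) powr s)"
    using e by (intro gagliardo_seminorm_Lipschitz s wiggle_Lipschitz) auto
  also have "\<dots> < \<infinity>" by simp
  finally have "gagliardo_seminorm s (1 / s) (wiggle \<epsilon>) < \<infinity>" .
  moreover have "wiggle \<epsilon> \<in> borel_measurable borel"
    by (intro borel_measurable_continuous_onI continuous_intros)
  from measurable_compose[OF measurable_arclength_borel this]
  have "wiggle \<epsilon> \<in> borel_measurable arclength" by simp
  ultimately show ?thesis
    by (auto simp: sobolev_circle_maps_def)
qed

section \<open>Degree of maps close to the identity\<close>

lemma norm_mean_le:
  fixes g :: "real \<Rightarrow> complex"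
  assumes \<eta>: "\<eta> > 0" and g: "continuous_on {-\<eta>..\<eta>} g"
    and B: "\<And>t. t \<in> {-\<eta>..\<eta>} \<Longrightarrow> norm (g t) \<le> B"
  shows "norm ((1 / (2 * \<eta>)) *\<^sub>R integral {-\<eta>..\<eta>} g) \<le> B"
proof -
  have "norm (integral {-\<eta>..\<eta>} g) \<le> B * (\<eta> - (- \<eta>))"
    using \<eta> by (intro integral_bound g B) auto
  then show ?thesis
    using \<eta> by (simp add: field_simps)
qed

lemma arc_mean_eq_integral:
  assumes u: "continuous_on unit_circle u" and x: "x \<in> unit_circle"
  shows "continuous_on {-\<eta>..\<eta>} (\<lambda>t. u (x * cis t))"
    and "arc_mean u \<eta> x = (1 / (2 * \<eta>)) *\<^sub>R integral {-\<eta>..\<eta>} (\<lambda>t. u (x * cis t))"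
proof -
  show c: "continuous_on {-\<eta>..\<eta>} (\<lambda>t. u (x * cis t))"
    by (rule continuous_on_compose2[OF u]) (use x in \<open>auto intro!: continuous_intros
      simp: norm_mult\<close>)
  show "arc_mean u \<eta> x = (1 / (2 * \<eta>)) *\<^sub>R integral {-\<eta>..\<eta>} (\<lambda>t. u (x * cis t))"
    using set_lebesgue_integral_eq_integral(2)[OF absolutely_integrable_continuous_real[OF c]]
    by (simp add: arc_mean_def)
qed

text \<open>For small radii the means stay within \<open>3 / 8\<close> of the identity and are Lipschitz; normalising
  at most doubles the distance, so the resulting loop stays closer to the standard circle than the
  circle is to \<open>0\<close>, and both wind once around \<open>0\<close>.\<close>

lemma has_vmo_degree_1_if_near_identity:
  assumes lip: "\<And>x y. x \<in> unit_circle \<Longrightarrow> y \<in> unit_circle \<Longrightarrow> norm (u x - u y) \<le> L * norm (x - y)"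
    and L: "L > 0" and near: "\<And>x. x \<in> unit_circle \<Longrightarrow> norm (u x - x) \<le> 1 / 4"
  shows "has_vmo_degree u 1"
proof -
  have "L-lipschitz_on unit_circle u"
    using L lip by (intro lipschitz_onI) (auto simp: dist_norm)
  then have u: "continuous_on unit_circle u"
    by (rule lipschitz_on_continuous_on)
  have rot: "x * cis t \<in> unit_circle" if "x \<in> unit_circle" for x t
    using that by (simp add: norm_mult)
  have main: "(\<forall>x\<in>unit_circle. arc_mean u \<eta> x \<noteq> 0) \<and>
       circle_degree (\<lambda>x. sgn (arc_mean u \<eta> x)) = of_int 1" if \<eta>: "0 < \<eta>" "\<eta> < 1 / (8 * L)" for \<eta>
  proof -
    note c = arc_mean_eq_integral(1)[OF u, of _ \<eta>] and m = arc_mean_eq_integral(2)[OF u, of _ \<eta>]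
    have "norm (arc_mean u \<eta> x - arc_mean u \<eta> y) \<le> L * norm (x - y)"
      if "x \<in> unit_circle" "y \<in> unit_circle" for x y
    proof -
      have "arc_mean u \<eta> x - arc_mean u \<eta> y = (1 / (2 * \<eta>)) *\<^sub>R integral {-\<eta>..\<eta>}
        (\<lambda>t. u (x * cis t) - u (y * cis t))"
        unfolding m[OF that(1)] m[OF that(2)]
        by (subst Henstock_Kurzweil_Integration.integral_diff) (auto
          intro!: integrable_continuous_real c that simp: scaleR_diff_right)
      also have "norm \<dots> \<le> L * norm (x - y)"
      proof (intro norm_mean_le \<eta> continuous_on_diff c that)
        fix t :: real
        show "norm (u (x * cis t) - u (y * cis t)) \<le> L * norm (x - y)"
          using lip[OF rot[OF that(1), of t] rot[OF that(2), of t]]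
            by (simp add: norm_mult flip: left_diff_distrib)
      qed
      finally show ?thesis .
    qed
    then have "L-lipschitz_on unit_circle (arc_mean u \<eta>)"
      using L by (intro lipschitz_onI) (auto simp: dist_norm)
    then have cont: "continuous_on unit_circle (arc_mean u \<eta>)"
      by (rule lipschitz_on_continuous_on)
    have close: "norm (arc_mean u \<eta> x - x) \<le> 3 / 8" if x: "x \<in> unit_circle" for x
    proof -
      have "arc_mean u \<eta> x - u x = (1 / (2 * \<eta>)) *\<^sub>R integral {-\<eta>..\<eta>} (\<lambda>t. u (x * cis t) - u x)"
        unfolding m[OF x] using \<eta>
        by (subst Henstock_Kurzweil_Integration.integral_diff) (auto
          intro!: integrable_continuous_real c x simp: scaleR_diff_right)
      also have "norm \<dots> \<le> L * \<eta>"
      proof (intro norm_mean_le \<eta> continuous_on_diff continuous_on_const c x)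
        fix t assume t: "t \<in> {-\<eta>..\<eta>}"
        have "norm (u (x * cis t) - u x) \<le> L * norm (x * (cis t - cis 0))"
          using lip[OF rot[OF x] x, of t] by (simp add: algebra_simps)
        also have "\<dots> \<le> L * \<eta>"
          using L x t norm_cis_diff_le[of t 0]
            by (intro mult_left_mono) (auto simp: norm_mult simp del: cis_zero)
        finally show "norm (u (x * cis t) - u x) \<le> L * \<eta>" .
      qed
      also have "L * \<eta> \<le> 1 / 8"
        using \<eta> L by (simp add: field_simps)
      finally show ?thesis
        using near[OF x] norm_triangle_ineq[of "arc_mean u \<eta> x - u x" "u x - x"] by simp
    qed
    have nz: "arc_mean u \<eta> x \<noteq> 0" if x: "x \<in> unit_circle" for x
      using close[OF x] x by auto
    have sgn_close: "norm (sgn (arc_mean u \<eta> x) - x) < 1" if x: "x \<in> unit_circle" for x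
    proof -
      let ?z = "arc_mean u \<eta> x"
      have "norm ?z *\<^sub>R sgn ?z = ?z"
        using nz[OF x] by (simp add: sgn_div_norm)
      then have "sgn ?z - ?z = (1 - norm ?z) *\<^sub>R sgn ?z"
        by (simp add: scaleR_diff_left)
      then have "norm (sgn ?z - ?z) = \<bar>1 - norm ?z\<bar>"
        using nz[OF x] by (simp add: norm_sgn)
      also have "\<dots> \<le> norm (?z - x)"
        using norm_triangle_ineq3[of x ?z] x by (simp add: norm_minus_commute)
      finally show ?thesis
        using close[OF x] norm_triangle_ineq[of "sgn ?z - ?z" "?z - x"] by simp
    qed
    define \<gamma> where "\<gamma> = (\<lambda>x. sgn (arc_mean u \<eta> x)) \<circ> circlepath 0 1"
    have im: "circlepath 0 1 t \<in> unit_circle" for t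
      by (simp add: circlepath norm_mult)
    have "winding_number \<gamma> 0 = winding_number (circlepath 0 1) 0"
    proof (rule winding_number_nearby_loops_eq)
      show "path \<gamma>"
        unfolding \<gamma>_def
        by (rule path_continuous_image) (auto intro!: continuous_on_sgn continuous_on_subset[OF cont]
          nz)
      show "norm (\<gamma> t - circlepath 0 1 t) < norm (circlepath 0 1 t - 0)" for t
        using sgn_close[OF im[of t]] im[of t] by (simp add: \<gamma>_def)
      show "pathfinish \<gamma> = pathstart \<gamma>"
        by (simp add: \<gamma>_def pathfinish_compose pathstart_compose)
    qed auto
    then show ?thesis
      using nz by (simp add: circle_degree_def \<gamma>_def winding_number_circlepath_centre)
  qed
  have "\<forall>\<^sub>F \<eta> in at_right 0. \<eta> \<in> {0<..<1 / (8 * L)}"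
    using L by (intro eventually_at_right_real) auto
  then show ?thesis
    unfolding has_vmo_degree_def by (rule eventually_mono) (use main in auto)
qed

section \<open>Instability of the identity\<close>

theorem theorem1p1:
  fixes s :: real
  assumes "0 < s" and "s < 1 / 8"
  shows "min_energy s 1 < energy s (\<lambda>x. x) \<and>
    (\<forall>r::real. 0 < r \<longrightarrow>
      (\<exists>u\<in>sobolev_circle_maps s. vmo_degree u = 1 \<and>
         gagliardo_seminorm s (1 / s) (\<lambda>x. u x - x) < ennreal r \<and>
         energy s u < energy s (\<lambda>x. x)))"
proof -
  have ex: "\<exists>u\<in>sobolev_circle_maps s. vmo_degree u = 1 \<and>
         gagliardo_seminorm s (1 / s) (\<lambda>x. u x - x) < ennreal r \<and>
         energy s u < energy s (\<lambda>x. x)" if r: "0 < r" for r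
  proof -
    define C where "C = (2 powr (1 / s - 2) * (2 * pi)\<^sup>2) powr s"
    have C: "C > 0" by (simp add: C_def)
    have "\<forall>\<^sub>F \<epsilon> in at_right 0. \<epsilon> \<in> {0<..<min (1 / 4) (r / (4 * C))}"
      using r C by (intro eventually_at_right_real) auto
    then have "\<forall>\<^sub>F \<epsilon> in at_right 0. energy s (wiggle \<epsilon>) < energy s (\<lambda>x. x)
        \<and> \<epsilon> \<in> {0<..<min (1 / 4) (r / (4 * C))}"
      by (intro eventually_conj energy_wiggle_less assms)
    then obtain \<epsilon> where less: "energy s (wiggle \<epsilon>) < energy s (\<lambda>x. x)"
      and \<epsilon>: "0 < \<epsilon>" "\<epsilon> \<le> 1 / 4" "\<epsilon> < r / (4 * C)"
      using eventually_happens'[OF trivial_limit_at_right_real]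
        by (metis (no_types, lifting) greaterThanLessThan_iff less_imp_le min_less_iff_conj)
    have "gagliardo_seminorm s (1 / s) (\<lambda>x. wiggle \<epsilon> x - x) \<le> ennreal (4 * \<epsilon> * C)"
      unfolding C_def using assms \<epsilon>
        by (intro gagliardo_seminorm_Lipschitz wiggle_minus_id_Lipschitz) auto
    also have "\<dots> < ennreal r"
      using \<epsilon> C r by (intro ennreal_lessI) (auto simp: field_simps)
    finally have "gagliardo_seminorm s (1 / s) (\<lambda>x. wiggle \<epsilon> x - x) < ennreal r" .
    moreover have "vmo_degree (wiggle \<epsilon>) = 1"
    proof (intro vmo_degree_eqI has_vmo_degree_1_if_near_identity[where L = "4 * \<epsilon> + 1"]
      wiggle_Lipschitz)
      show "norm (wiggle \<epsilon> x - x) \<le> 1 / 4" if "x \<in> unit_circle" for x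
        using norm_wiggle_minus_id_le[OF that, of \<epsilon>] \<epsilon> by simp
    qed (use \<epsilon> in auto)
    moreover have "wiggle \<epsilon> \<in> sobolev_circle_maps s"
      using assms \<epsilon> by (intro wiggle_in_sobolev_circle_maps) auto
    ultimately show ?thesis
      using less by blast
  qed
  from ex[of 1] obtain u where u: "u \<in> sobolev_circle_maps s" "vmo_degree u = 1"
    "energy s u < energy s (\<lambda>x. x)"
    by auto
  have "min_energy s 1 \<le> energy s u"
    unfolding min_energy_def using u by (intro Inf_lower) auto
  with u(3) have "min_energy s 1 < energy s (\<lambda>x. x)"
    by simp
  with ex show ?thesis by blast
qed

end
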